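(* Every $4$-partite $4$-uniform hypergraph $H$ with matching number $\nu(H)=2$ satisfies $\tau(H)\le 6$.
   Context: A $4$-partite $4$-uniform hypergraph $H$ has a vertex set partitioned into four pairwise disjoint parts $V_1,V_2,V_3,V_4$, and each edge is a set of four vertices containing exactly one vertex of each part. A matching in $H$ is a set of pairwise disjoint edges; $\nu(H)$ is the maximum size of a matching in $H$. A vertex cover of $H$ is a set of vertices that meets every edge of $H$; $\tau(H)$ is the minimum size of a vertex cover of $H$. *)

theory Defs
  imports Main "HOL-Library.Extended_Nat" "HOL-Library.Disjoint_Sets"
begin

definition uniform_hypergraph :: "nat \<Rightarrow> 'a set \<Rightarrow> 'a set set \<Rightarrow> bool" where
  "uniform_hypergraph k V E \<longleftrightarrow> (\<forall>e\<in>E. e \<subseteq> V \<and> finite e \<and> card e = k)"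

definition partite_hypergraph :: "nat \<Rightarrow> (nat \<Rightarrow> 'a set) \<Rightarrow> 'a set \<Rightarrow> 'a set set \<Rightarrow> bool" where
  "partite_hypergraph k P V E \<longleftrightarrow>
     V = (\<Union>i\<in>{1..k}. P i) \<and> disjoint_family_on P {1..k} \<and>
     (\<forall>e\<in>E. \<forall>i\<in>{1..k}. \<exists>!v. v \<in> e \<inter> P i)"

definition matching :: "'a set set \<Rightarrow> 'a set set \<Rightarrow> bool" where
  "matching E M \<longleftrightarrow> M \<subseteq> E \<and> disjoint M"

definition vertex_cover :: "'a set \<Rightarrow> 'a set set \<Rightarrow> 'a set \<Rightarrow> bool" where
  "vertex_cover V E C \<longleftrightarrow> C \<subseteq> V \<and> (\<forall>e\<in>E. e \<inter> C \<noteq> {})"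

text \<open>
  Hypergraphs may be infinite, so both parameters take values in the extended naturals;
  this also avoids the convention that infinite sets have cardinality 0. Since subsets of
  matchings are matchings, an infinite matching makes the supremum below infinite. When the
  supremum (resp. infimum) is finite, it is attained, i.e. a maximum (resp. minimum). The
  infimum is infinite exactly when there is no finite vertex cover.
\<close>

definition matching_number :: "'a set set \<Rightarrow> enat" where
  "matching_number E = Sup {enat (card M) | M. matching E M \<and> finite M}"

definition vertex_cover_number :: "'a set \<Rightarrow> 'a set set \<Rightarrow> enat" where
  "vertex_cover_number V E = Inf {enat (card C) | C. vertex_cover V E C \<and> finite C}"

end

theory Submission
  imports Defs "HOL-Combinatorics.Permutations"
begin

text \<open>
  Represent an edge by the function sending each part to its vertex there, and suppose that no six
  vertices meet all edges. Given any finite configuration of edges and six of its vertices, some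
  edge avoids these six; it can be placed relative to the configuration in finitely many ways. So a
  configuration cannot occur if, for a suitable choice of the six vertices, each of these ways
  creates either three disjoint edges or a configuration already excluded. A sequence
  of such exclusions, found by computer search, ends with the configuration of two disjoint edges,
  which contradicts \<open>\<nu> = 2\<close>.
\<close>

section \<open>Configurations of edges\<close>

definition crossing :: "(nat \<Rightarrow> 'a) \<Rightarrow> (nat \<Rightarrow> 'a) \<Rightarrow> bool" where
  "crossing e f \<longleftrightarrow> (\<exists>p<4. e p = f p)"

text \<open>The clauses say \<open>\<nu> \<le> 2\<close> and \<open>\<tau> > 6\<close> for the edge
  set \<open>T\<close>. Repetitions among \<open>d\<close>, \<open>e\<close>, \<open>f\<close> are
  harmless, because an edge crosses itself. Each vertex is tagged with its part, so equal values in
  different parts are unrelated.\<close>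

definition counterexample :: "(nat \<Rightarrow> 'a) set \<Rightarrow> bool" where
  "counterexample T \<longleftrightarrow>
     (\<forall>d\<in>T. \<forall>e\<in>T. \<forall>f\<in>T. crossing d e \<or> crossing d f \<or> crossing e f) \<and>
     (\<forall>A. finite A \<and> card A \<le> 6 \<longrightarrow> (\<exists>e\<in>T. \<forall>(p, v)\<in>A. p < 4 \<longrightarrow> e p \<noteq> v))"

text \<open>
  In a configuration an edge is the list of the labels of its four vertices. Distinct labels in the
  same part stand for distinct vertices; the same label in two parts has no significance.
\<close>

type_synonym edge = "nat list"

text \<open>The permutation \<open>\<pi>\<close> makes occurrence invariant under reordering the
  parts, so a configuration has to be excluded only once up to this symmetry.\<close>

definition realizes ::
  "(nat \<Rightarrow> 'a) set \<Rightarrow> edge list \<Rightarrow> (edge \<Rightarrow> nat \<Rightarrow> 'a) \<Rightarrow> (nat \<Rightarrow> nat) \<Rightarrow> bool" where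
  "realizes T K f \<pi> \<longleftrightarrow> \<pi> permutes {..<4} \<and> (\<forall>x\<in>set K. f x \<in> T) \<and>
     (\<forall>x\<in>set K. \<forall>y\<in>set K. \<forall>p<4. x ! p = y ! p \<longleftrightarrow> f x (\<pi> p) = f y (\<pi> p))"

definition occurs :: "(nat \<Rightarrow> 'a) set \<Rightarrow> edge list \<Rightarrow> bool" where
  "occurs T K \<longleftrightarrow> (\<exists>f \<pi>. realizes T K f \<pi>)"

lemma realizesD:
  assumes "realizes T K f \<pi>"
  shows "\<pi> permutes {..<4}"
    and "x \<in> set K \<Longrightarrow> f x \<in> T"
    and "x \<in> set K \<Longrightarrow> y \<in> set K \<Longrightarrow> p < 4 \<Longrightarrow> x ! p = y ! p \<longleftrightarrow> f x (\<pi> p) = f y (\<pi> p)"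
  using assms by (auto simp: realizes_def)

section \<open>Disjoint edges within a configuration\<close>

definition disjoint_edges :: "edge \<Rightarrow> edge \<Rightarrow> bool" where
  "disjoint_edges x y \<longleftrightarrow> list_all2 (\<noteq>) x y"

definition three_disjoint :: "edge list \<Rightarrow> edge \<Rightarrow> bool" where
  "three_disjoint K g \<longleftrightarrow>
     (let L = filter (disjoint_edges g) K in list_ex (\<lambda>x. list_ex (disjoint_edges x) L) L)"

text \<open>A part in which \<open>e\<close> and \<open>f\<close> met would be the image under
  \<open>\<pi>\<close> of a part in which the labels of \<open>x\<close> and \<open>y\<close>
  agree.\<close>

lemma not_crossing_if_disjoint_edges:
  assumes "\<pi> permutes {..<4}" and "disjoint_edges x y" and "length x = 4"
    and "\<And>p. p < 4 \<Longrightarrow> x ! p = y ! p \<longleftrightarrow> e (\<pi> p) = f (\<pi> p)"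
  shows "\<not> crossing e f"
proof
  assume "crossing e f"
  then obtain q where q: "q < 4" "e q = f q"
    by (auto simp: crossing_def)
  obtain p where p: "p < 4" "\<pi> p = q"
    using assms(1) q(1) by (metis lessThan_iff permutes_def permutes_in_image)
  show False
    using assms(2-4) p q(2) by (auto simp: disjoint_edges_def list_all2_conv_all_nth)
qed

text \<open>A realization preserves disjointness, so \<open>g\<close> and the two edges of
  \<open>K\<close> found by \<open>three_disjoint\<close> would violate the first clause of
  \<open>counterexample\<close>.\<close>

lemma not_occurs_if_three_disjoint:
  assumes T: "counterexample T" and len: "\<And>x. x \<in> set (g # K) \<Longrightarrow> length x = 4"
    and "three_disjoint K g"
  shows "\<not> occurs T (g # K)"
proof
  assume "occurs T (g # K)"
  then obtain f \<pi> where r: "realizes T (g # K) f \<pi>"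
    by (auto simp: occurs_def)
  note \<pi> = realizesD(1)[OF r] and fT = realizesD(2)[OF r] and f = realizesD(3)[OF r]
  have nc: "\<not> crossing (f x) (f y)"
    if "disjoint_edges x y" "x \<in> set (g # K)" "y \<in> set (g # K)" for x y
    using not_crossing_if_disjoint_edges[OF \<pi> that(1) len[OF that(2)] f[OF that(2,3)]] .
  obtain x y where xy: "x \<in> set K" "y \<in> set K"
    "disjoint_edges g x" "disjoint_edges g y" "disjoint_edges x y"
    using assms(3) by (auto simp: three_disjoint_def list_ex_iff)
  then have "\<not> crossing (f g) (f x)" "\<not> crossing (f g) (f y)" "\<not> crossing (f x) (f y)"
    by (simp_all add: nc)
  moreover have "f g \<in> T" "f x \<in> T" "f y \<in> T"
    using fT xy(1,2) by simp_all
  ultimately show False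
    using T by (auto simp: counterexample_def)
qed

section \<open>Copies of one configuration inside another\<close>

text \<open>Edges of \<open>K\<close> go to edges of \<open>L\<close> by position, and
  \<open>\<sigma>\<close> lists the images of the parts. Labels themselves need not correspond; only
  the pattern of agreements in each part is compared.\<close>

definition embeds :: "edge list \<Rightarrow> nat list \<Rightarrow> edge list \<Rightarrow> bool" where
  "embeds K \<sigma> L \<longleftrightarrow> length L = length K \<and> distinct \<sigma> \<and> length \<sigma> = 4 \<and> list_all (\<lambda>p. p < 4) \<sigma> \<and>
     list_all (\<lambda>(x, x'). list_all (\<lambda>(y, y').
       list_all (\<lambda>p. x ! p = y ! p \<longleftrightarrow> x' ! (\<sigma> ! p) = y' ! (\<sigma> ! p)) [0, 1, 2, 3]) (zip K L)) (zip K L)"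

text \<open>An injection of a finite set into itself is onto. The function is the identity beyond
  the list because \<open>permutes\<close> demands this.\<close>

lemma nth_permutes:
  assumes "distinct \<sigma>" "length \<sigma> = n" "list_all (\<lambda>p. p < n) \<sigma>"
  shows "(\<lambda>p. if p < n then \<sigma> ! p else p) permutes {..<n}"
proof (rule bij_imp_permutes)
  let ?s = "\<lambda>p. if p < n then \<sigma> ! p else p"
  have "inj_on ?s {..<n}"
    using assms by (auto simp: inj_on_def nth_eq_iff_index_eq)
  moreover have "?s ` {..<n} \<subseteq> {..<n}"
    using assms by (auto simp: list_all_length)
  ultimately show "bij_betw ?s {..<n} {..<n}"
    unfolding bij_betw_def using endo_inj_surj[of "{..<n}" ?s] by blast
qed simp

text \<open>An embedding followed by a realization is a realization. Read contrapositively, every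
  configuration containing a copy of an excluded one is excluded.\<close>

lemma occurs_if_embeds:
  assumes "occurs T M" and "embeds K \<sigma> L" and "set L \<subseteq> set M"
  shows "occurs T K"
proof -
  obtain f \<pi> where r: "realizes T M f \<pi>"
    using assms(1) by (auto simp: occurs_def)
  note \<pi> = realizesD(1)[OF r] and fT = realizesD(2)[OF r] and f = realizesD(3)[OF r]
  define s where "s p = (if p < 4 then \<sigma> ! p else p)" for p
  have s: "s permutes {..<4}"
    using nth_permutes[of \<sigma> 4] assms(2) by (simp add: embeds_def s_def[abs_def])
  have len: "length L = length K"
    using assms(2) by (simp add: embeds_def)
  \<comment> \<open>An edge repeated in \<open>K\<close> may have several partners in
    \<open>L\<close>; any choice serves, since \<open>embeds\<close> compares all pairs of
    positions.\<close>
  have "\<exists>m. \<forall>x\<in>set K. (x, m x) \<in> set (zip K L)"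
    by (rule bchoice) (metis in_set_impl_in_set_zip1 len)
  then obtain m where m: "\<And>x. x \<in> set K \<Longrightarrow> (x, m x) \<in> set (zip K L)"
    by blast
  then have mM: "m x \<in> set M" if "x \<in> set K" for x
    using that assms(3) by (meson set_zip_rightD subsetD)
  have emb: "x ! p = y ! p \<longleftrightarrow> m x ! s p = m y ! s p"
    if "x \<in> set K" "y \<in> set K" "p < 4" for x y p
  proof -
    have "p \<in> set [0, 1, 2, 3]"
      using that(3) by auto
    then show ?thesis
      using assms(2) m[OF that(1)] m[OF that(2)] that(3)
      unfolding embeds_def s_def list_all_iff by fastforce
  qed
  have sp: "s p < 4" if "p < 4" for p
    using permutes_in_image[OF s, of p] that by simp
  show ?thesis
    unfolding occurs_def realizes_def
  proof (intro exI conjI ballI allI impI)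
    show "(\<pi> \<circ> s) permutes {..<4}"
      using s \<pi> by (rule permutes_compose)
    show "(f \<circ> m) x \<in> T" if "x \<in> set K" for x
      using fT mM that by simp
    show "x ! p = y ! p \<longleftrightarrow> (f \<circ> m) x ((\<pi> \<circ> s) p) = (f \<circ> m) y ((\<pi> \<circ> s) p)"
      if "x \<in> set K" "y \<in> set K" "p < 4" for x y p
      using emb[OF that] f[OF mM[OF that(1)] mM[OF that(2)] sp[OF that(3)]] by simp
  qed
qed

section \<open>Adding an edge that avoids six vertices\<close>

text \<open>The label 9 stands for a vertex outside the configuration.\<close>

definition choices :: "edge list \<Rightarrow> (nat \<times> nat) list \<Rightarrow> nat \<Rightarrow> nat list" where
  "choices K S p = 9 # filter (\<lambda>l. \<not> List.member S (p, l)) (remdups (map (\<lambda>x. x ! p) K))"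

definition placements :: "edge list \<Rightarrow> (nat \<times> nat) list \<Rightarrow> edge list" where
  "placements K S = product_lists (map (choices K S) [0, 1, 2, 3])"

text \<open>The second clause of \<open>counterexample\<close> yields an edge of \<open>T\<close>
  avoiding the vertices named by \<open>S\<close>. Reading off its label in each part, with
  \<open>9\<close> for a vertex outside the configuration, gives the placement
  \<open>g\<close>.\<close>

lemma placement_occurs:
  assumes T: "counterexample T" and "occurs T K" and S: "length S \<le> 6"
    and fresh: "\<And>x p. x \<in> set K \<Longrightarrow> p < 4 \<Longrightarrow> x ! p \<noteq> 9"
  obtains g where "g \<in> set (placements K S)" "occurs T (g # K)"
proof -
  obtain f \<pi> where r: "realizes T K f \<pi>"
    using assms(2) by (auto simp: occurs_def)
  note \<pi> = realizesD(1)[OF r] and fT = realizesD(2)[OF r] and f = realizesD(3)[OF r]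
  \<comment> \<open>A label becomes a vertex through any edge of \<open>K\<close> carrying it; by
    \<open>realizes\<close> all such edges give the same vertex. A pair carried by no edge gives an
    arbitrary vertex, which is then avoided too.\<close>
  define A where "A = (\<lambda>(p, l). (\<pi> p, f (SOME x. x \<in> set K \<and> x ! p = l) (\<pi> p))) ` set S"
  have "finite A" "card A \<le> 6"
    using S card_length[of S] card_image_le[of "set S"] unfolding A_def by (auto intro: order_trans)
  then have "\<exists>e\<in>T. \<forall>(p, v)\<in>A. p < 4 \<longrightarrow> e p \<noteq> v"
    using T by (simp add: counterexample_def)
  then obtain e where e: "e \<in> T" and eA: "\<And>p v. (p, v) \<in> A \<Longrightarrow> p < 4 \<Longrightarrow> e p \<noteq> v"
    by blast
  have \<pi>4: "\<pi> p < 4" if "p < 4" for p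
    using permutes_in_image[OF \<pi>, of p] that by simp
  have avoid: "e (\<pi> p) \<noteq> f x (\<pi> p)" if "(p, x ! p) \<in> set S" "x \<in> set K" "p < 4" for x p
  proof -
    define y where "y = (SOME y. y \<in> set K \<and> y ! p = x ! p)"
    have y: "y \<in> set K \<and> y ! p = x ! p"
      unfolding y_def by (rule someI[of _ x]) (use that in simp)
    have "(\<pi> p, f y (\<pi> p)) \<in> A"
      unfolding A_def y_def using that(1) by force
    then have "e (\<pi> p) \<noteq> f y (\<pi> p)"
      using eA \<pi>4[OF that(3)] by blast
    then show ?thesis
      using f[of y x p] y that by simp
  qed
  \<comment> \<open>Any edge of \<open>K\<close> through the vertex of \<open>e\<close> in part
    \<open>\<pi> p\<close> supplies the same label. By \<open>fresh\<close>, the default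
    \<open>9\<close> never coincides with a label of \<open>K\<close>.\<close>
  define lab where "lab p = (if \<exists>x\<in>set K. f x (\<pi> p) = e (\<pi> p)
    then (SOME x. x \<in> set K \<and> f x (\<pi> p) = e (\<pi> p)) ! p else 9)" for p
  have lab: "lab p = x ! p \<longleftrightarrow> e (\<pi> p) = f x (\<pi> p)" if "x \<in> set K" "p < 4" for x p
  proof (cases "\<exists>x\<in>set K. f x (\<pi> p) = e (\<pi> p)")
    case True
    define y where "y = (SOME x. x \<in> set K \<and> f x (\<pi> p) = e (\<pi> p))"
    have "y \<in> set K \<and> f y (\<pi> p) = e (\<pi> p)"
      unfolding y_def by (rule someI_ex) (use True in blast)
    moreover have "lab p = y ! p"
      using True by (simp add: lab_def y_def)
    ultimately show ?thesis
      using f[of y x p] that by simp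
  next
    case False
    then have "lab p = 9"
      by (simp add: lab_def)
    moreover have "e (\<pi> p) \<noteq> f x (\<pi> p)"
      using False that by metis
    ultimately show ?thesis
      using fresh[OF that] by simp
  qed
  have lab_choices: "lab p \<in> set (choices K S p)" if "p < 4" for p
  proof (cases "\<exists>x\<in>set K. lab p = x ! p")
    case True
    then obtain x where x: "x \<in> set K" "lab p = x ! p"
      by blast
    then have "(p, lab p) \<notin> set S"
      using avoid[of p x] lab[of x p] that by auto
    then show ?thesis
      using x by (auto simp: choices_def)
  next
    case False
    then have "\<not> (\<exists>x\<in>set K. f x (\<pi> p) = e (\<pi> p))"
      using lab[OF _ that] by (auto dest: sym)
    then have "lab p = 9"
      by (simp add: lab_def)
    then show ?thesis
      by (simp add: choices_def)
  qed
  define g where "g = map lab [0, 1, 2, 3]"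
  have g: "g ! p = lab p" if "p < 4" for p
  proof -
    have "p \<in> {0, 1, 2, 3}"
      using that by auto
    then show ?thesis
      by (auto simp: g_def)
  qed
  have "g \<in> set (placements K S)"
    unfolding placements_def g_def product_lists_set
    using lab_choices by simp
  moreover have "occurs T (g # K)"
    unfolding occurs_def realizes_def
  proof (intro exI conjI ballI allI impI)
    \<comment> \<open>If \<open>g\<close> is already an edge of \<open>K\<close>, overwriting its
      image is harmless: by \<open>lab\<close>, the edge \<open>e\<close> agrees with the old image
      in all four parts.\<close>
    let ?h = "f(g := e)"
    show "\<pi> permutes {..<4}"
      by (rule \<pi>)
    show "?h x \<in> T" if "x \<in> set (g # K)" for x
      using that e fT by auto
    show "x ! p = y ! p \<longleftrightarrow> ?h x (\<pi> p) = ?h y (\<pi> p)"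
      if "x \<in> set (g # K)" "y \<in> set (g # K)" "p < 4" for x y p
      using that f[of x y p] lab[of x p] lab[of y p] g[of p] by auto
  qed
  ultimately show thesis
    by (rule that)
qed

section \<open>Certificates of exclusion\<close>

text \<open>
  A step \<open>(K, S, W)\<close> excludes \<open>K\<close> by means of six vertices \<open>S\<close>, given as pairs of a part and a label.
  A witness \<open>(g, j, \<sigma>, is)\<close> says that the \<open>j\<close>-th excluded configuration appears, after permuting
  the parts by \<open>\<sigma>\<close>, as the edges with indices \<open>is\<close> of the configuration extended by \<open>g\<close> at its end.
\<close>

type_synonym witness = "edge \<times> nat \<times> nat list \<times> nat list"
type_synonym step = "edge list \<times> (nat \<times> nat) list \<times> witness list"

definition valid_witness :: "edge list list \<Rightarrow> edge list \<Rightarrow> witness \<Rightarrow> bool" where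
  "valid_witness X K = (\<lambda>(g, j, \<sigma>, is).
     j < length X \<and> list_all (\<lambda>i. i \<le> length K) is \<and>
     embeds (X ! j) \<sigma> (map (\<lambda>i. (K @ [g]) ! i) is))"

text \<open>Placements that create three disjoint edges are recognised directly, so \<open>W\<close>
  need only cover the others. Barring \<open>9\<close> from \<open>K\<close> keeps that label free
  for new vertices.\<close>

definition valid_step :: "edge list list \<Rightarrow> step \<Rightarrow> bool" where
  "valid_step X = (\<lambda>(K, S, W).
     length S \<le> 6 \<and>
     list_all (\<lambda>x. length x = 4 \<and> \<not> List.member x 9) K \<and>
     list_all (valid_witness X K) W \<and>
     list_all (\<lambda>g. three_disjoint K g \<or> list_ex (\<lambda>w. fst w = g) W) (placements K S))"

text \<open>Appending preserves positions: when the check starts from \<open>[]\<close>, the index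
  \<open>j\<close> in a witness is the position, counted from 0, of an earlier step. Circular
  exclusions are thereby impossible.\<close>

fun valid_steps :: "edge list list \<Rightarrow> step list \<Rightarrow> bool" where
  "valid_steps X [] \<longleftrightarrow> True"
| "valid_steps X (s # ss) \<longleftrightarrow> valid_step X s \<and> valid_steps (X @ [fst s]) ss"

text \<open>If \<open>K\<close> occurred, it would also occur together with some placement
  \<open>g\<close> avoiding \<open>S\<close>. Then \<open>T\<close> would contain three disjoint
  edges or a configuration from \<open>X\<close>.\<close>

lemma not_occurs_if_valid_step:
  assumes T: "counterexample T" and X: "\<And>L. L \<in> set X \<Longrightarrow> \<not> occurs T L"
    and "valid_step X (K, S, W)"
  shows "\<not> occurs T K"
proof
  assume K: "occurs T K"
  have valid: "length S \<le> 6" "\<And>x. x \<in> set K \<Longrightarrow> length x = 4 \<and> 9 \<notin> set x"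
    "\<And>w. w \<in> set W \<Longrightarrow> valid_witness X K w"
    "\<And>g. g \<in> set (placements K S) \<Longrightarrow> three_disjoint K g \<or> (\<exists>w\<in>set W. fst w = g)"
    using assms(3) by (auto simp: valid_step_def list_all_iff list_ex_iff)
  have "x ! p \<noteq> 9" if "x \<in> set K" "p < 4" for x p
    using valid(2)[OF that(1)] that(2) nth_mem by metis
  then obtain g where g: "g \<in> set (placements K S)" and gK: "occurs T (g # K)"
    using placement_occurs[OF T K valid(1)] by blast
  have "length g = 4"
    using g in_set_product_lists_length by (fastforce simp: placements_def)
  then have "\<not> three_disjoint K g"
    using not_occurs_if_three_disjoint[OF T, of g K] gK valid(2) by auto
  then obtain j \<sigma> "is" where "valid_witness X K (g, j, \<sigma>, is)"
    using valid(3,4) g by fastforce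
  then have j: "j < length X" and "is": "\<And>i. i \<in> set is \<Longrightarrow> i \<le> length K"
    and emb: "embeds (X ! j) \<sigma> (map (\<lambda>i. (K @ [g]) ! i) is)"
    by (auto simp: valid_witness_def list_all_iff)
  \<comment> \<open>Witnesses put \<open>g\<close> last so that the edges of \<open>K\<close> keep
    their indices. Occurrence depends only on the set of edges, so \<open>g # K\<close> serves
    equally well.\<close>
  have "(K @ [g]) ! i \<in> set (g # K)" if "i \<in> set is" for i
    using nth_mem[of i "K @ [g]"] "is"[OF that] by simp
  then have "set (map (\<lambda>i. (K @ [g]) ! i) is) \<subseteq> set (g # K)"
    by auto
  from occurs_if_embeds[OF gK emb this] show False
    using X j by simp
qed

text \<open>Once verified, a step joins the excluded configurations available to the remaining ones;
  hence the induction on the steps with \<open>X\<close> arbitrary.\<close>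

lemma not_occurs_if_valid_steps:
  assumes "counterexample T" "\<And>L. L \<in> set X \<Longrightarrow> \<not> occurs T L" "valid_steps X ss" "s \<in> set ss"
  shows "\<not> occurs T (fst s)"
  using assms(2-4)
proof (induction ss arbitrary: X)
  case (Cons t ts)
  have t: "\<not> occurs T (fst t)"
    using not_occurs_if_valid_step[OF assms(1), of X "fst t" "fst (snd t)" "snd (snd t)"] Cons.prems
    by simp
  show ?case
  proof (cases "s = t")
    case False
    then show ?thesis
      using Cons.prems t by (intro Cons.IH[of "X @ [fst t]"]) auto
  qed (use t in simp)
qed simp

section \<open>The list of exclusions and its verification\<close>

text \<open>An empty witness list means that every placement creates three disjoint edges. In the
  last step, the six vertices are those of two disjoint edges in parts 0, 1 and 2. A new edge then
  either misses both edges or meets exactly one of them, in part 3 only; the latter is, up to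
  permuting parts, the configuration excluded just before.\<close>

definition certificate :: "step list" where
  "certificate = [
  ([[0,0,0,0],[1,1,1,1],[2,2,2,0],[3,1,3,2],[4,3,0,0],[3,1,4,3]],
   [(1,1),(3,0),(2,0),(0,3),(2,2),(0,1)],
   []),
  ([[0,0,0,0],[1,1,1,1],[2,2,2,0],[3,3,0,0],[1,1,3,1]],
   [(0,1),(1,1),(3,0),(3,1),(2,0),(2,2)],
   []),
  ([[0,0,0,0],[1,1,1,1],[1,2,2,2],[2,3,3,0],[3,2,1,3],[4,4,0,0],[3,1,4,2]],
   [(3,0),(2,0),(2,1),(2,3),(2,2),(2,4)],
   [([1,1,9,3],0,[0,1,2,3],[0,6,3,1,5,7]),
    ([1,2,9,2],1,[0,1,2,3],[0,2,3,5,7]),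
    ([3,1,9,2],1,[0,1,2,3],[0,6,3,5,7]),
    ([3,2,9,1],0,[0,1,2,3],[0,2,3,4,5,7])]),
  ([[0,0,0,0],[1,1,1,1],[1,2,2,2],[2,3,3,0],[3,2,1,3],[4,4,0,0],[5,2,4,1]],
   [(3,0),(2,0),(2,1),(3,1),(0,1),(2,3)],
   [([3,1,4,2],2,[0,1,2,3],[0,1,2,3,4,5,7]),
    ([5,1,2,3],2,[0,1,2,3],[0,2,1,3,7,5,6])]),
  ([[0,0,0,0],[1,1,1,1],[2,2,2,0],[3,1,3,2],[4,3,0,0],[2,1,4,3],[2,1,5,3]],
   [(1,1),(3,0),(2,0),(2,2),(2,1),(2,3)],
   []),
  ([[0,0,0,0],[1,1,1,1],[1,2,2,2],[2,3,3,0],[3,2,1,3],[4,4,0,0],[2,2,4,1],[2,1,2,3]],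
   [(3,0),(2,0),(2,3),(2,1),(2,2),(2,4)],
   [([1,2,9,3],0,[1,0,2,3],[0,1,3,2,5,8]),
    ([2,2,9,1],4,[0,1,2,3],[0,2,3,4,5,6,8])]),
  ([[0,0,0,0],[1,1,1,1],[1,2,2,2],[2,3,3,0],[3,2,1,3],[4,4,0,0],[2,2,4,1]],
   [(3,0),(2,1),(3,1),(2,0),(2,3),(0,1)],
   [([2,1,2,3],5,[0,1,2,3],[0,1,2,3,4,5,6,7]),
    ([3,1,4,2],2,[0,1,2,3],[0,1,2,3,4,5,7])]),
  ([[0,0,0,0],[1,1,1,1],[2,2,2,0],[3,1,3,2],[4,3,0,0],[0,1,4,3],[0,1,5,3]],
   [(1,1),(3,0),(2,0),(2,2),(2,1),(2,3)],
   []),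
  ([[0,0,0,0],[1,1,1,1],[1,2,2,2],[2,3,3,0],[3,2,1,3],[4,4,0,0],[0,2,4,1],[0,1,2,3]],
   [(3,0),(2,0),(2,1),(2,4),(2,2),(2,3)],
   [([0,2,9,1],7,[0,1,2,3],[0,2,3,4,5,6,8]),
    ([1,2,9,3],0,[1,0,2,3],[0,1,3,2,5,8])]),
  ([[0,0,0,0],[1,1,1,1],[1,2,2,2],[2,3,3,0],[3,2,1,3],[4,4,0,0],[0,2,4,1]],
   [(3,0),(2,0),(2,1),(0,1),(3,1),(2,3)],
   [([0,1,2,3],8,[0,1,2,3],[0,1,2,3,4,5,6,7]),
    ([3,1,4,2],2,[0,1,2,3],[0,1,2,3,4,5,7])]),
  ([[0,0,0,0],[1,1,1,1],[1,2,2,2],[2,3,3,0],[3,2,1,3],[4,4,0,0]],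
   [(3,0),(0,1),(2,0),(2,1),(2,2),(2,3)],
   [([0,2,9,1],9,[0,1,2,3],[0,1,2,3,4,5,6]),
    ([2,2,9,1],6,[0,1,2,3],[0,1,2,3,4,5,6]),
    ([3,1,9,2],2,[0,1,2,3],[0,1,2,3,4,5,6]),
    ([3,2,9,1],0,[0,1,2,3],[0,2,3,4,5,6]),
    ([4,2,9,1],9,[0,1,2,3],[5,1,2,3,4,0,6]),
    ([9,2,9,1],3,[0,1,2,3],[0,1,2,3,4,5,6])]),
  ([[0,0,0,0],[1,1,1,1],[0,0,0,2],[2,1,1,1]],
   [(0,0),(1,0),(1,1),(2,0),(2,1),(3,1)],
   []),
  ([[0,0,0,0],[1,1,1,1],[2,2,2,0],[3,0,2,2],[2,3,0,2],[1,1,1,3]],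
   [(0,1),(1,1),(2,1),(0,2),(0,0),(0,3)],
   [([9,0,0,0],11,[0,1,2,3],[1,0,5,6]),
    ([9,0,2,2],11,[0,1,2,3],[1,3,5,6]),
    ([9,2,0,2],1,[0,1,3,2],[4,1,0,6,5]),
    ([9,3,2,0],1,[0,1,3,2],[2,1,3,6,5])]),
  ([[0,0,0,0],[1,1,1,0],[2,0,1,1],[1,2,0,1],[3,3,2,2],[3,4,2,2]],
   [(0,3),(2,2),(3,2),(0,1),(2,1),(2,0)],
   [([0,1,9,1],12,[0,2,3,1],[1,4,6,2,0,5]),
    ([2,2,9,0],12,[0,2,3,1],[0,4,2,3,6,5])]),
  ([[0,0,0,0],[1,1,1,1],[2,2,2,0],[3,0,2,2],[4,3,1,3],[4,1,3,4],[2,4,0,2],[1,5,3,3]],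
   [(1,0),(1,1),(1,2),(1,4),(1,3),(1,5)],
   [([0,9,2,2],10,[0,1,2,3],[3,4,5,6,1,8]),
    ([1,9,1,4],10,[1,3,2,0],[1,0,3,7,6,8]),
    ([1,9,3,3],13,[0,1,2,3],[0,2,3,6,7,8]),
    ([2,9,0,2],13,[3,1,0,2],[1,4,5,7,6,8]),
    ([2,9,2,0],13,[3,1,0,2],[1,4,5,7,2,8]),
    ([3,9,0,0],10,[0,1,2,3],[0,4,5,2,1,8]),
    ([4,9,1,3],13,[0,1,2,3],[0,2,3,6,4,8]),
    ([4,9,3,1],10,[1,3,2,0],[5,0,3,4,6,8])]),
  ([[0,0,0,0],[1,1,1,1],[1,2,2,2],[2,0,3,3],[3,2,1,4],[3,1,4,2],[2,3,5,0],[0,3,3,5]],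
   [(2,1),(2,3),(0,0),(0,1),(0,2),(0,3)],
   [([9,0,5,5],14,[0,2,1,3],[6,1,0,8,5,4,7,2]),
    ([9,1,2,4],14,[0,2,1,3],[2,3,5,8,0,7,4,6]),
    ([9,2,4,1],14,[0,2,1,3],[5,3,2,8,0,7,1,6]),
    ([9,3,0,3],14,[0,2,1,3],[0,1,6,8,5,4,3,2])]),
  ([[0,0,0,0],[1,1,1,1],[1,2,2,2],[2,3,3,0],[3,0,3,3],[4,2,1,4],[4,1,4,2],[3,4,5,0]],
   [(2,1),(3,0),(3,4),(3,2),(3,3),(3,1)],
   [([0,4,3,9],15,[0,1,2,3],[0,1,2,4,5,6,7,8]),
    ([1,2,4,9],10,[2,3,0,1],[2,4,3,5,7,8]),
    ([2,0,5,9],14,[1,3,0,2],[3,2,4,7,1,6,8,5]),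
    ([3,0,3,9],13,[2,3,0,1],[2,5,6,1,4,8]),
    ([3,3,0,9],14,[0,3,1,2],[0,2,8,3,5,6,4,1]),
    ([4,1,2,9],10,[2,3,0,1],[6,4,3,1,7,8])]),
  ([[0,0,0,0],[1,1,1,0],[2,0,1,1],[3,2,2,2],[3,2,3,2],[2,3,4,0]],
   [(0,3),(1,2),(3,2),(3,0),(2,1),(3,1)],
   [([1,0,4,9],12,[1,3,0,2],[1,3,2,5,6,4]),
    ([2,1,0,9],12,[0,3,1,2],[0,3,6,1,2,4])]),
  ([[0,0,0,0],[1,1,1,1],[1,2,2,2],[2,3,3,0],[3,0,3,3],[4,1,4,2],[4,1,5,2],[4,4,2,1],[4,5,2,1]],
   [(1,1),(3,1),(3,3),(3,0),(3,2),(0,4)],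
   [([0,0,3,9],10,[0,3,1,2],[4,1,2,3,5,9]),
    ([0,2,3,9],17,[0,3,1,2],[3,4,0,7,8,9]),
    ([0,3,3,9],10,[0,3,1,2],[3,1,2,4,5,9]),
    ([0,4,3,9],16,[0,3,1,2],[3,1,2,4,0,5,8,9]),
    ([0,5,3,9],16,[0,3,1,2],[3,1,2,4,0,5,7,9]),
    ([0,9,3,9],17,[0,3,1,2],[3,4,0,7,8,9]),
    ([1,0,3,9],1,[0,3,1,2],[4,7,3,9,8]),
    ([2,0,0,9],1,[0,3,2,1],[0,5,4,9,6]),
    ([2,0,1,9],17,[0,3,2,1],[0,4,3,5,6,9]),
    ([2,0,2,9],17,[0,3,2,1],[0,4,3,5,6,9]),
    ([2,0,3,9],1,[0,3,2,1],[4,5,0,9,6]),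
    ([2,0,4,9],16,[0,3,2,1],[0,2,1,4,3,7,6,9]),
    ([2,0,5,9],16,[0,3,2,1],[0,2,1,4,3,7,5,9]),
    ([2,0,9,9],17,[0,3,2,1],[0,4,3,5,6,9]),
    ([3,0,3,9],12,[1,2,0,3],[2,4,5,7,1,9]),
    ([3,3,0,9],12,[0,3,1,2],[0,5,9,3,4,6]),
    ([9,0,3,9],1,[0,3,1,2],[4,7,3,9,8])]),
  ([[0,0,0,0],[1,1,1,1],[1,2,2,2],[2,3,3,0],[3,0,3,3],[4,2,1,4],[4,1,4,2],[4,1,5,2],[4,4,2,1]],
   [(1,1),(1,2),(2,3),(1,0),(1,3),(1,4)],
   [([2,9,0,3],12,[0,1,3,2],[0,6,9,4,3,7]),
    ([3,9,0,0],10,[0,1,2,3],[0,1,2,3,5,9]),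
    ([3,9,1,0],17,[0,1,2,3],[0,3,4,6,7,9]),
    ([3,9,2,0],17,[0,1,2,3],[0,3,4,6,7,9]),
    ([3,9,4,0],16,[0,1,2,3],[0,1,2,3,4,5,7,9]),
    ([3,9,5,0],16,[0,1,2,3],[0,1,2,3,4,5,6,9]),
    ([3,9,9,0],17,[0,1,2,3],[0,3,4,6,7,9]),
    ([4,9,1,2],10,[1,2,3,0],[6,0,4,8,3,9]),
    ([4,9,2,1],18,[0,1,2,3],[0,1,2,3,4,6,7,8,9])]),
  ([[0,0,0,0],[1,1,1,1],[1,2,2,2],[2,3,3,0],[3,0,3,3],[4,2,1,4],[4,1,4,2],[4,1,5,2]],
   [(2,1),(1,1),(1,2),(2,3),(1,0),(1,3)],
   [([2,9,0,3],12,[0,1,3,2],[0,6,8,4,3,7]),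
    ([3,9,0,0],10,[0,1,2,3],[0,1,2,3,5,8]),
    ([3,9,2,0],17,[0,1,2,3],[0,3,4,6,7,8]),
    ([3,9,4,0],16,[0,1,2,3],[0,1,2,3,4,5,7,8]),
    ([3,9,5,0],16,[0,1,2,3],[0,1,2,3,4,5,6,8]),
    ([3,9,9,0],17,[0,1,2,3],[0,3,4,6,7,8]),
    ([4,9,2,1],19,[0,1,2,3],[0,1,2,3,4,5,6,7,8])]),
  ([[0,0,0,0],[1,1,1,1],[1,2,2,2],[2,3,3,0],[3,0,3,3],[4,2,1,4],[4,1,4,2],[2,0,5,5]],
   [(0,2),(2,1),(1,0),(1,2),(1,1),(1,3)],
   [([0,9,3,5],14,[1,2,0,3],[3,1,0,8,2,5,7,6]),
    ([1,9,4,4],16,[0,2,3,1],[4,5,6,0,3,8,1,7]),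
    ([3,9,5,0],14,[1,3,0,2],[3,2,4,8,1,6,7,5]),
    ([4,9,2,1],16,[0,2,3,1],[4,1,2,0,3,8,5,7])]),
  ([[0,0,0,0],[1,1,1,1],[1,2,2,2],[2,3,3,0],[3,0,3,3],[4,2,1,4],[4,1,4,2],[0,1,3,5]],
   [(2,1),(2,3),(2,2),(3,0),(2,4),(2,0)],
   [([0,3,9,3],14,[0,2,1,3],[3,1,0,4,6,5,8,2]),
    ([1,1,9,4],10,[2,3,1,0],[1,4,3,2,0,8]),
    ([1,2,9,2],20,[0,1,2,3],[0,5,6,3,4,1,2,8]),
    ([2,0,9,5],21,[0,1,2,3],[0,1,2,3,4,5,6,8]),
    ([4,1,9,2],20,[0,1,2,3],[0,1,2,3,4,5,6,8]),
    ([4,2,9,1],10,[2,3,0,1],[5,7,3,2,0,8])]),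
  ([[0,0,0,0],[1,1,1,1],[1,2,2,2],[2,3,3,0],[3,0,3,3],[4,2,1,4],[4,1,4,2]],
   [(2,1),(2,3),(1,0),(2,2),(2,4),(2,0)],
   [([0,3,9,3],14,[0,2,1,3],[3,1,0,4,6,5,7,2]),
    ([1,1,9,4],10,[2,3,1,0],[1,4,3,2,0,7]),
    ([1,2,9,2],20,[0,1,2,3],[0,5,6,3,4,1,2,7]),
    ([3,1,9,0],22,[0,1,3,2],[4,6,5,3,0,2,1,7]),
    ([3,2,9,0],22,[0,1,3,2],[4,2,1,3,0,6,5,7]),
    ([3,3,9,0],10,[0,2,1,3],[3,2,1,0,5,7]),
    ([3,9,9,0],16,[0,1,2,3],[0,1,2,3,4,5,6,7]),
    ([4,1,9,2],20,[0,1,2,3],[0,1,2,3,4,5,6,7]),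
    ([4,2,9,1],10,[2,3,1,0],[5,4,3,6,0,7])]),
  ([[0,0,0,0],[1,1,1,1],[1,2,2,2],[2,3,3,0],[3,0,3,3],[4,2,1,4],[2,3,0,3]],
   [(0,1),(1,0),(1,2),(2,1),(1,3),(1,1)],
   [([0,9,3,3],10,[0,1,2,3],[4,1,2,6,5,7]),
    ([2,9,0,3],23,[3,2,0,1],[5,3,0,2,1,7,4]),
    ([2,9,3,0],23,[3,2,0,1],[5,6,4,2,1,7,0]),
    ([3,9,0,0],10,[0,1,2,3],[0,1,2,3,5,7]),
    ([4,9,2,1],23,[0,2,1,3],[3,2,1,0,4,5,7])]),
  ([[0,0,0,0],[1,1,1,1],[1,2,2,2],[2,3,3,0],[3,0,3,3],[4,2,1,4],[5,3,0,3]],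
   [(3,4),(1,0),(1,1),(1,2),(1,3),(2,1)],
   [([0,9,3,3],10,[0,1,2,3],[4,1,2,6,5,7]),
    ([2,9,0,3],10,[0,1,2,3],[6,1,2,4,5,7]),
    ([3,9,0,0],10,[0,1,2,3],[0,1,2,3,5,7]),
    ([4,9,2,1],23,[0,2,1,3],[0,2,1,3,6,5,7]),
    ([5,9,3,0],10,[0,1,2,3],[3,1,2,0,5,7])]),
  ([[0,0,0,0],[1,1,1,1],[1,2,2,2],[2,2,1,3],[1,3,3,3],[3,0,0,0]],
   [(1,0),(2,0),(3,0),(1,2),(2,1),(3,3)],
   [([2,1,3,2],12,[1,2,3,0],[4,0,2,6,3,5]),
    ([2,3,2,1],12,[1,2,3,0],[1,0,4,3,6,5])]),
  ([[0,0,0,0],[1,1,1,1],[1,2,2,2],[2,3,3,0],[3,0,3,3],[4,2,1,4],[1,4,4,4],[4,3,0,3]],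
   [(0,1),(0,4),(0,0),(0,2),(0,3),(1,0)],
   [([9,1,2,4],25,[0,1,2,3],[0,2,1,3,4,8,7]),
    ([9,2,1,4],25,[0,1,2,3],[0,1,2,3,4,8,7]),
    ([9,2,4,1],25,[0,1,2,3],[0,6,2,3,4,8,7]),
    ([9,3,0,3],25,[0,1,2,3],[0,1,2,3,4,5,8]),
    ([9,3,3,0],26,[0,1,2,3],[3,1,2,5,6,8]),
    ([9,4,1,2],25,[0,1,2,3],[0,1,6,3,4,8,7])]),
  ([[0,0,0,0],[1,1,1,1],[1,2,2,2],[2,3,3,0],[3,0,3,3],[4,2,1,4],[1,4,4,4],[0,3,3,2]],
   [(2,3),(1,0),(3,4),(2,1),(1,2),(1,3)],
   [([4,1,4,2],23,[0,1,2,3],[0,1,2,3,4,5,8]),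
    ([4,4,2,1],10,[0,3,1,2],[3,6,1,4,8,7])]),
  ([[0,0,0,0],[1,1,1,1],[1,2,2,2],[2,3,3,0],[3,0,3,3],[4,2,1,4],[1,4,4,4],[1,3,0,3]],
   [(1,2),(2,3),(1,0),(3,4),(2,1),(1,3)],
   [([2,1,0,3],23,[2,3,0,1],[5,3,4,2,6,8,0]),
    ([2,4,0,3],23,[3,2,0,1],[5,3,0,2,1,8,4]),
    ([2,9,0,3],23,[2,3,0,1],[5,3,4,2,6,8,0]),
    ([3,1,0,0],28,[0,2,3,1],[4,6,1,0,3,5,2,8]),
    ([3,4,0,0],10,[0,1,2,3],[0,1,2,3,5,8]),
    ([3,9,0,0],10,[0,1,2,3],[0,1,2,3,5,8]),
    ([4,1,4,2],23,[0,1,2,3],[0,1,2,3,4,5,8]),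
    ([4,4,2,1],23,[0,1,2,3],[0,2,6,3,4,8,5])]),
  ([[0,0,0,0],[1,1,1,1],[1,2,2,2],[2,3,3,0],[3,0,3,3],[4,2,1,4],[1,4,4,4]],
   [(0,0),(1,0),(3,0),(2,1),(3,4),(1,2)],
   [([1,3,0,3],29,[0,1,2,3],[0,1,2,3,4,5,6,7]),
    ([2,1,0,3],23,[2,3,0,1],[5,3,4,2,6,7,0]),
    ([2,3,0,3],24,[0,1,2,3],[0,1,2,3,4,5,7]),
    ([2,4,0,3],23,[3,2,0,1],[5,3,0,2,1,7,4]),
    ([2,9,0,3],23,[2,3,0,1],[5,3,4,2,6,7,0]),
    ([3,3,0,1],23,[2,1,0,3],[5,4,3,6,2,7,0]),
    ([3,3,0,2],23,[1,2,0,3],[5,4,0,6,1,7,3]),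
    ([3,3,0,3],24,[0,3,1,2],[0,2,6,7,3,5,4]),
    ([3,3,0,9],23,[1,2,0,3],[5,4,0,6,1,7,3]),
    ([4,1,4,2],23,[0,1,2,3],[0,1,2,3,4,5,7]),
    ([4,3,0,3],27,[0,1,2,3],[0,1,2,3,4,5,6,7]),
    ([4,4,2,1],23,[0,1,2,3],[0,2,6,3,4,7,5]),
    ([9,3,0,3],25,[0,1,2,3],[0,1,2,3,4,5,7])]),
  ([[0,0,0,0],[1,1,1,1],[1,2,2,2],[2,3,3,0],[3,0,3,3],[4,2,1,4],[3,1,4,0],[1,4,0,4]],
   [(0,1),(0,2),(0,3),(3,0),(3,4),(3,2)],
   [([0,1,3,1],30,[2,0,1,3],[7,8,4,5,2,6,3]),
    ([0,1,3,3],10,[0,1,3,2],[4,7,2,3,5,8]),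
    ([0,1,3,9],30,[2,0,1,3],[7,8,4,5,2,6,3]),
    ([0,2,0,1],30,[1,0,2,3],[6,8,2,3,4,7,5]),
    ([0,3,4,3],23,[2,3,0,1],[5,4,3,2,7,6,8]),
    ([4,2,0,1],10,[2,3,0,1],[5,4,3,2,6,8]),
    ([4,4,2,1],23,[0,2,1,3],[3,2,1,0,4,5,8]),
    ([9,2,0,1],30,[1,0,2,3],[6,8,2,3,4,7,5])]),
  ([[0,0,0,0],[1,1,1,0],[2,2,2,1],[3,3,3,0],[3,4,4,0]],
   [(0,2),(1,2),(2,2),(3,0),(3,1),(0,3)],
   []),
  ([[0,0,0,0],[1,1,1,1],[1,2,2,2],[2,3,3,0],[3,0,3,3],[4,2,1,4],[3,1,4,0]],
   [(1,2),(2,1),(1,0),(1,1),(2,3),(1,3)],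
   [([1,9,0,4],31,[0,1,2,3],[0,1,2,3,4,5,6,7]),
    ([1,9,2,4],10,[1,3,2,0],[2,4,0,1,3,7]),
    ([1,9,4,4],30,[0,1,2,3],[0,1,2,3,4,5,7]),
    ([1,9,9,4],30,[0,1,2,3],[0,1,2,3,4,5,7]),
    ([3,9,0,0],10,[0,1,2,3],[0,1,2,3,5,7]),
    ([3,9,2,0],32,[0,1,2,3],[0,3,5,6,7]),
    ([3,9,4,0],30,[3,0,1,2],[1,0,7,5,2,4,3]),
    ([3,9,9,0],32,[0,1,2,3],[0,3,2,6,7]),
    ([4,9,2,1],23,[0,2,1,3],[3,2,1,0,4,5,7])]),
  ([[0,0,0,0],[1,1,1,1],[1,2,2,2],[2,3,3,0],[3,0,3,3],[4,2,1,4]],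
   [(2,3),(1,0),(1,2),(2,1),(1,1),(1,3)],
   [([1,9,0,4],33,[3,2,1,0],[1,0,3,2,5,4,6]),
    ([1,9,2,4],10,[1,3,2,0],[2,4,0,1,3,6]),
    ([1,9,9,4],30,[0,1,2,3],[0,1,2,3,4,5,6]),
    ([2,9,0,3],23,[3,2,0,1],[5,3,0,2,1,6,4]),
    ([3,9,0,0],10,[0,1,2,3],[0,1,2,3,5,6]),
    ([3,9,2,0],33,[0,2,1,3],[3,2,1,0,4,5,6]),
    ([3,9,9,0],30,[3,0,1,2],[1,0,6,5,2,4,3]),
    ([4,9,2,1],23,[0,2,1,3],[3,2,1,0,4,5,6])]),
  ([[0,0,0,0],[1,1,1,1],[2,2,2,0],[3,1,3,2],[4,1,4,1]],
   [(3,0),(1,2),(1,0),(1,1),(3,1),(3,2)],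
   [([0,9,2,9],10,[0,2,3,1],[1,0,5,3,2,4]),
    ([2,9,0,9],10,[0,2,3,1],[1,2,5,3,0,4])]),
  ([[0,0,0,0],[1,1,1,1],[1,2,2,2],[2,3,3,0],[3,1,4,2],[4,0,3,1],[3,4,2,1]],
   [(3,0),(1,1),(1,0),(0,0),(3,2),(3,1)],
   [([1,4,4,9],34,[0,2,3,1],[5,2,7,0,3,4]),
    ([3,2,1,9],34,[0,1,3,2],[5,4,7,3,0,2]),
    ([4,3,0,9],34,[0,1,3,2],[7,2,1,0,3,4])]),
  ([[0,0,0,0],[1,1,1,1],[1,2,2,2],[2,3,3,0],[3,1,4,2],[4,0,3,1]],
   [(1,0),(1,1),(3,2),(1,2),(1,3),(3,0)],
   [([0,9,3,1],35,[0,2,1,3],[2,5,4,3,6]),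
    ([0,9,3,9],34,[1,0,3,2],[6,4,1,3,0,2]),
    ([1,9,4,1],35,[1,0,2,3],[0,1,3,2,6]),
    ([1,9,4,9],34,[0,2,3,1],[5,2,6,0,3,4]),
    ([2,9,0,1],36,[2,0,1,3],[2,6,0,4,3,1,5]),
    ([3,9,2,1],36,[0,1,2,3],[0,1,2,3,4,5,6])]),
  ([[0,0,0,0],[1,1,1,1],[2,2,2,0],[3,1,3,2],[4,1,4,3],[1,2,0,4]],
   [(1,1),(1,2),(3,0),(0,2),(2,2),(0,1)],
   [([3,0,1,3],37,[0,3,2,1],[2,6,3,5,4,0]),
    ([3,0,4,1],37,[0,2,3,1],[5,6,3,2,4,0]),
    ([3,9,1,3],34,[0,1,3,2],[5,6,3,0,2,4]),
    ([3,9,4,1],34,[0,1,2,3],[2,6,3,0,5,4]),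
    ([4,0,1,2],37,[0,3,2,1],[2,6,4,5,3,0]),
    ([4,0,3,1],37,[0,2,3,1],[5,6,4,2,3,0]),
    ([4,9,1,2],34,[0,1,3,2],[5,6,4,0,2,3]),
    ([4,9,3,1],34,[0,1,2,3],[2,6,4,0,5,3])]),
  ([[0,0,0,0],[1,1,1,1],[1,2,2,2],[2,3,3,0],[3,0,3,3],[3,1,4,2],[4,1,2,3]],
   [(2,3),(3,0),(3,3),(3,2),(3,1),(1,1)],
   [([1,3,0,9],38,[0,1,2,3],[0,1,3,5,6,7]),
    ([2,0,0,9],37,[2,1,3,0],[1,4,3,2,7,5]),
    ([2,0,1,9],34,[0,1,3,2],[6,3,7,2,5,0]),
    ([2,0,2,9],38,[2,1,0,3],[3,6,0,1,5,7]),
    ([2,0,4,9],34,[2,0,1,3],[3,6,2,0,7,1]),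
    ([2,0,9,9],34,[0,1,3,2],[6,3,7,2,5,0]),
    ([3,3,0,9],34,[0,1,2,3],[3,2,1,0,7,6])]),
  ([[0,0,0,0],[1,1,1,1],[1,2,2,2],[2,3,3,0],[3,0,3,3],[3,1,4,2]],
   [(0,1),(0,3),(3,0),(0,0),(0,2),(3,2)],
   [([9,0,3,1],37,[0,1,2,3],[0,1,2,3,5,6]),
    ([9,0,3,3],34,[0,1,3,2],[6,2,1,3,0,5]),
    ([9,0,3,9],34,[0,1,3,2],[6,2,1,3,0,5]),
    ([9,1,2,1],35,[0,1,2,3],[0,1,3,5,6]),
    ([9,1,2,3],39,[0,1,2,3],[0,1,2,3,4,5,6]),
    ([9,1,2,9],34,[0,1,2,3],[0,2,1,3,4,6]),
    ([9,2,4,1],34,[0,1,3,2],[4,1,2,3,0,6]),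
    ([9,3,0,3],34,[0,1,3,2],[6,2,1,0,3,5])]),
  ([[0,0,0,0],[1,1,1,1],[1,2,2,2],[2,3,3,0],[3,0,3,3],[0,3,3,4]],
   [(0,1),(1,0),(2,3),(1,1),(1,2),(1,3)],
   [([0,9,1,2],40,[0,3,1,2],[3,2,1,4,0,6]),
    ([0,9,2,1],40,[0,3,1,2],[3,1,2,4,0,6]),
    ([2,9,1,2],34,[1,0,2,3],[2,4,0,6,1,5]),
    ([2,9,2,1],34,[1,0,2,3],[1,4,0,6,2,5]),
    ([3,9,1,2],37,[1,2,3,0],[1,4,0,2,5,6]),
    ([3,9,2,1],37,[1,2,3,0],[2,4,0,1,5,6]),
    ([9,9,1,2],34,[0,2,3,1],[4,2,1,0,3,6]),
    ([9,9,2,1],34,[0,2,3,1],[4,1,2,0,3,6])]),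
  ([[0,0,0,0],[1,1,1,1],[1,2,2,2],[2,3,3,0],[3,0,3,3],[3,3,0,4],[4,0,0,0]],
   [(0,1),(0,3),(0,2),(3,0),(1,1),(1,2)],
   [([0,0,1,2],40,[1,2,3,0],[1,3,5,2,7,4]),
    ([0,0,2,1],40,[1,2,3,0],[2,3,5,1,7,4]),
    ([0,0,3,4],41,[0,1,2,3],[5,1,2,7,3,4]),
    ([0,3,0,3],41,[0,1,2,3],[4,1,2,7,6,5]),
    ([0,3,1,2],40,[1,2,3,0],[1,6,4,2,7,5]),
    ([0,3,2,1],40,[1,2,3,0],[2,6,4,1,7,5]),
    ([0,9,1,2],34,[0,2,3,1],[4,2,1,6,3,7]),
    ([0,9,2,1],34,[0,2,3,1],[4,1,2,6,3,7]),
    ([4,0,1,2],40,[1,2,3,0],[1,3,5,2,7,4]),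
    ([4,0,2,1],40,[1,2,3,0],[2,3,5,1,7,4]),
    ([4,0,3,4],41,[0,1,2,3],[5,1,2,7,3,4]),
    ([4,3,0,3],41,[0,1,2,3],[4,1,2,7,0,5]),
    ([4,3,1,2],40,[1,2,3,0],[1,0,4,2,7,5]),
    ([4,3,2,1],40,[1,2,3,0],[2,0,4,1,7,5]),
    ([4,9,1,2],34,[0,2,3,1],[4,2,1,0,3,7]),
    ([4,9,2,1],34,[0,2,3,1],[4,1,2,0,3,7]),
    ([9,0,1,2],40,[1,2,3,0],[1,3,5,2,7,4]),
    ([9,0,2,1],40,[1,2,3,0],[2,3,5,1,7,4]),
    ([9,0,3,4],41,[0,1,2,3],[5,1,2,7,3,4]),
    ([9,3,0,3],41,[0,1,2,3],[4,1,2,7,0,5]),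
    ([9,3,1,2],40,[1,2,3,0],[1,0,4,2,7,5]),
    ([9,3,2,1],40,[1,2,3,0],[2,0,4,1,7,5]),
    ([9,9,1,2],34,[0,2,3,1],[4,2,1,0,3,7]),
    ([9,9,2,1],34,[0,2,3,1],[4,1,2,0,3,7])]),
  ([[0,0,0,0],[1,1,1,1],[1,2,2,2],[2,3,3,0],[3,0,3,3],[3,3,0,4]],
   [(0,1),(0,3),(0,0),(0,2),(1,1),(1,2)],
   [([9,0,0,0],42,[0,1,2,3],[0,1,2,3,4,5,6]),
    ([9,0,1,2],40,[1,2,3,0],[1,3,5,2,6,4]),
    ([9,0,2,1],40,[1,2,3,0],[2,3,5,1,6,4]),
    ([9,0,3,4],41,[0,1,2,3],[5,1,2,6,3,4]),
    ([9,3,0,3],41,[0,1,2,3],[4,1,2,6,0,5]),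
    ([9,3,1,2],40,[1,2,3,0],[1,0,4,2,6,5]),
    ([9,3,2,1],40,[1,2,3,0],[2,0,4,1,6,5]),
    ([9,3,3,0],42,[0,1,2,3],[3,1,2,0,5,4,6]),
    ([9,9,1,2],34,[0,2,3,1],[4,2,1,0,3,6]),
    ([9,9,2,1],34,[0,2,3,1],[4,1,2,0,3,6])]),
  ([[0,0,0,0],[1,1,1,1],[1,2,2,2],[2,3,3,0],[3,0,3,3],[2,4,2,1],[0,2,4,1]],
   [(0,0),(0,1),(0,2),(0,3),(1,0),(3,1)],
   [([9,1,3,0],40,[1,3,0,2],[5,0,4,2,1,7]),
    ([9,2,3,0],40,[1,2,0,3],[5,4,0,1,2,7]),
    ([9,3,0,3],34,[0,1,3,2],[3,1,2,4,7,6]),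
    ([9,3,3,0],34,[0,2,3,1],[4,1,2,0,7,5]),
    ([9,4,3,0],35,[0,2,1,3],[1,3,6,4,7]),
    ([9,9,3,0],35,[0,2,1,3],[1,3,6,4,7])]),
  ([[0,0,0,0],[1,1,1,1],[1,2,2,2],[2,3,3,0],[3,0,3,3],[2,4,2,1],[0,2,3,4]],
   [(1,0),(2,3),(2,0),(2,1),(2,2),(0,1)],
   [([0,2,9,1],44,[0,1,2,3],[0,1,2,3,4,5,7]),
    ([0,3,9,3],34,[1,0,3,2],[2,4,0,5,1,7]),
    ([2,1,9,2],34,[2,0,1,3],[5,4,6,1,7,0]),
    ([2,2,9,1],40,[0,3,2,1],[0,1,2,4,3,7]),
    ([3,2,9,0],40,[1,0,2,3],[1,4,0,5,2,7]),
    ([3,2,9,1],40,[0,1,2,3],[0,2,1,3,4,7]),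
    ([9,2,9,1],34,[0,1,3,2],[4,1,2,3,0,7])]),
  ([[0,0,0,0],[1,1,1,1],[1,2,2,2],[2,3,3,0],[3,0,3,3],[2,4,2,1]],
   [(0,1),(1,0),(2,1),(2,2),(2,3),(2,0)],
   [([0,2,9,1],44,[0,1,2,3],[0,1,2,3,4,5,6]),
    ([0,3,9,3],34,[1,0,3,2],[2,4,0,5,1,6]),
    ([2,1,9,2],40,[0,3,2,1],[0,2,1,4,3,6]),
    ([2,2,9,1],40,[0,3,2,1],[0,1,2,4,3,6]),
    ([3,1,9,0],45,[0,1,3,2],[4,2,1,3,0,5,6]),
    ([3,2,9,0],40,[1,0,2,3],[1,4,0,5,2,6]),
    ([3,2,9,1],40,[0,1,2,3],[0,2,1,3,4,6]),
    ([3,3,9,0],34,[1,0,3,2],[2,0,4,5,1,6]),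
    ([3,4,9,0],40,[1,3,2,0],[1,0,4,2,5,6]),
    ([3,9,9,0],34,[1,0,3,2],[2,0,4,5,1,6]),
    ([9,2,9,1],34,[0,1,3,2],[4,1,2,3,0,6])]),
  ([[0,0,0,0],[1,1,1,1],[1,2,2,2],[2,3,3,0],[3,0,3,3],[0,4,3,4]],
   [(0,1),(0,0),(1,0),(3,0),(1,1),(1,2)],
   [([2,3,1,2],34,[1,0,2,3],[2,4,0,6,1,5]),
    ([2,3,2,1],34,[1,0,2,3],[1,4,0,6,2,5]),
    ([2,4,0,3],43,[0,1,2,3],[4,1,2,6,0,5]),
    ([2,4,1,2],40,[1,2,3,0],[1,4,0,2,6,5]),
    ([2,4,2,1],40,[1,2,3,0],[2,4,0,1,6,5]),
    ([2,9,1,2],34,[1,0,2,3],[2,4,0,6,1,5]),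
    ([2,9,2,1],34,[1,0,2,3],[1,4,0,6,2,5]),
    ([3,3,0,4],43,[0,1,2,3],[0,1,2,3,4,6]),
    ([3,3,1,2],37,[1,2,3,0],[1,4,0,2,5,6]),
    ([3,3,2,1],37,[1,2,3,0],[2,4,0,1,5,6]),
    ([3,4,1,2],40,[0,2,1,3],[3,1,2,0,4,6]),
    ([3,4,2,1],40,[0,2,1,3],[3,2,1,0,4,6]),
    ([3,9,1,2],37,[1,2,3,0],[1,4,0,2,5,6]),
    ([3,9,2,1],37,[1,2,3,0],[2,4,0,1,5,6]),
    ([9,3,1,2],34,[1,0,2,3],[2,4,0,6,1,5]),
    ([9,3,2,1],34,[1,0,2,3],[1,4,0,6,2,5]),
    ([9,4,1,2],34,[0,2,3,1],[4,2,1,0,3,6]),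
    ([9,4,2,1],34,[0,2,3,1],[4,1,2,0,3,6]),
    ([9,9,1,2],34,[0,2,3,1],[4,2,1,0,3,6]),
    ([9,9,2,1],34,[0,2,3,1],[4,1,2,0,3,6])]),
  ([[0,0,0,0],[1,1,1,1],[1,2,2,2],[2,3,3,0],[3,0,3,3],[2,0,2,4],[0,4,3,1]],
   [(0,1),(1,0),(2,3),(2,1),(2,2),(2,0)],
   [([0,1,9,2],40,[2,0,3,1],[1,3,4,7,2,5]),
    ([0,2,9,1],46,[0,2,1,3],[3,1,2,0,4,7]),
    ([2,1,9,2],40,[0,3,2,1],[0,2,1,4,3,7]),
    ([2,2,9,1],40,[0,3,2,1],[0,1,2,4,3,7]),
    ([3,2,9,1],40,[0,1,2,3],[0,2,1,3,4,7]),
    ([9,2,9,1],34,[0,1,3,2],[4,1,2,3,0,7])]),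
  ([[0,0,0,0],[1,1,1,1],[1,2,2,2],[2,3,3,0],[3,0,3,3],[2,0,2,4]],
   [(0,1),(1,0),(2,3),(2,1),(2,2),(2,0)],
   [([0,1,9,2],40,[2,0,3,1],[1,3,4,6,2,5]),
    ([0,2,9,1],46,[0,2,1,3],[3,1,2,0,4,6]),
    ([2,1,9,2],40,[0,3,2,1],[0,2,1,4,3,6]),
    ([2,2,9,1],40,[0,3,2,1],[0,1,2,4,3,6]),
    ([3,1,9,0],48,[0,3,1,2],[3,2,1,4,0,6,5]),
    ([3,1,9,2],40,[0,1,2,3],[0,1,2,3,4,6]),
    ([3,2,9,1],40,[0,1,2,3],[0,2,1,3,4,6]),
    ([9,1,9,2],34,[0,1,3,2],[4,2,1,3,0,6]),
    ([9,2,9,1],34,[0,1,3,2],[4,1,2,3,0,6])]),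
  ([[0,0,0,0],[1,1,1,1],[1,2,2,2],[2,3,3,0],[3,0,3,3]],
   [(0,1),(1,0),(2,3),(1,1),(1,2),(1,3)],
   [([0,9,1,2],40,[0,3,1,2],[3,2,1,4,0,5]),
    ([0,9,2,1],40,[0,3,1,2],[3,1,2,4,0,5]),
    ([2,9,0,3],43,[0,2,3,1],[0,1,2,4,5,3]),
    ([2,9,1,2],46,[0,1,2,3],[0,2,1,3,4,5]),
    ([2,9,2,1],46,[0,1,2,3],[0,1,2,3,4,5]),
    ([3,9,0,0],41,[0,2,3,1],[4,1,2,0,3,5]),
    ([3,9,1,0],49,[0,3,2,1],[0,2,1,4,3,5]),
    ([3,9,1,2],40,[0,2,1,3],[3,1,2,0,4,5]),
    ([3,9,2,0],49,[0,3,2,1],[0,1,2,4,3,5]),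
    ([3,9,2,1],40,[0,2,1,3],[3,2,1,0,4,5]),
    ([3,9,9,0],47,[0,1,3,2],[4,1,2,3,0,5]),
    ([9,9,1,2],34,[0,2,3,1],[4,2,1,0,3,5]),
    ([9,9,2,1],34,[0,2,3,1],[4,1,2,0,3,5])]),
  ([[0,0,0,0],[1,1,1,1],[1,2,2,2],[2,3,3,0]],
   [(0,1),(3,0),(0,0),(0,2),(3,2),(3,1)],
   [([9,0,3,9],50,[0,1,2,3],[0,1,2,3,4]),
    ([9,1,2,9],50,[3,0,1,2],[2,0,3,4,1]),
    ([9,2,1,9],50,[3,0,1,2],[1,0,3,4,2]),
    ([9,3,0,9],50,[0,1,2,3],[3,1,2,0,4])]),
  ([[0,0,0,0],[1,1,1,1],[1,2,2,2],[2,3,2,1],[3,0,0,3],[2,1,3,2]],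
   [(1,0),(1,1),(2,0),(2,3),(0,2),(3,2)],
   [([0,2,1,3],51,[0,1,2,3],[4,3,5,6]),
    ([0,2,2,3],51,[0,2,3,1],[1,0,6,5]),
    ([0,2,9,3],51,[0,1,2,3],[1,0,6,3]),
    ([0,3,1,3],51,[0,1,2,3],[2,0,6,5]),
    ([0,3,2,3],51,[0,2,3,1],[1,0,6,5]),
    ([0,3,9,3],51,[0,1,2,3],[2,0,6,5]),
    ([0,9,1,3],51,[0,1,2,3],[2,0,6,5]),
    ([0,9,2,3],51,[0,2,3,1],[1,0,6,5]),
    ([0,9,9,3],51,[0,1,2,3],[1,0,6,3]),
    ([3,2,1,0],51,[0,1,2,3],[0,3,5,6]),
    ([3,2,2,0],51,[0,2,3,1],[1,4,6,5]),
    ([3,2,9,0],51,[0,1,2,3],[0,3,5,6]),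
    ([3,3,1,0],51,[0,1,2,3],[2,4,6,5]),
    ([3,3,2,0],51,[0,2,3,1],[1,4,6,5]),
    ([3,3,9,0],51,[0,1,2,3],[0,1,2,6]),
    ([3,9,1,0],51,[0,1,2,3],[0,3,5,6]),
    ([3,9,2,0],51,[0,2,3,1],[1,4,6,5]),
    ([3,9,9,0],51,[0,1,2,3],[0,1,2,6])]),
  ([[0,0,0,0],[1,1,1,1],[1,2,2,2],[2,3,2,1],[3,0,0,3]],
   [(0,1),(1,0),(2,0),(2,2),(1,2),(2,1)],
   [([0,1,9,3],51,[0,1,3,2],[2,0,5,3]),
    ([0,3,9,3],51,[0,1,2,3],[4,1,2,5]),
    ([0,9,9,3],51,[0,1,2,3],[1,0,5,3]),
    ([2,1,9,2],52,[0,1,2,3],[0,1,2,3,4,5]),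
    ([3,1,9,0],51,[0,1,3,2],[2,4,5,3]),
    ([3,3,9,0],51,[0,1,2,3],[0,1,2,5]),
    ([3,9,9,0],51,[0,1,2,3],[0,1,2,5])]),
  ([[0,0,0,0],[1,1,1,1],[1,2,2,2],[0,3,3,3]],
   [(0,0),(0,1),(1,0),(1,1),(1,2),(1,3)],
   [([9,9,0,3],51,[0,1,2,3],[3,1,2,4]),
    ([9,9,1,2],51,[0,1,2,3],[2,0,3,4]),
    ([9,9,2,1],51,[0,1,2,3],[1,0,3,4]),
    ([9,9,3,0],51,[0,1,2,3],[0,1,2,4])]),
  ([[0,0,0,0],[1,1,1,1],[1,2,2,2],[2,0,2,3],[3,1,3,0]],
   [(0,1),(1,0),(1,1),(2,2),(1,2),(3,0)],
   [([0,9,3,1],54,[2,0,1,3],[2,4,5,3]),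
    ([0,9,3,3],54,[0,1,2,3],[0,1,2,5]),
    ([2,9,0,2],51,[0,2,3,1],[1,3,5,4]),
    ([2,9,1,2],54,[3,0,1,2],[0,2,5,4]),
    ([3,9,0,1],51,[0,1,3,2],[2,4,5,3]),
    ([3,9,0,3],51,[0,1,3,2],[0,1,2,5]),
    ([3,9,1,2],51,[1,0,3,2],[1,0,3,5])]),
  ([[0,0,0,0],[1,1,1,1],[1,2,2,2],[2,3,2,1],[1,3,3,3]],
   [(0,1),(0,0),(0,2),(3,1),(2,2),(1,3)],
   [([9,0,0,0],26,[0,1,2,3],[0,2,4,3,1,5]),
    ([9,0,0,2],53,[0,2,1,3],[0,1,4,3,5]),
    ([9,0,0,3],53,[0,1,2,3],[0,1,2,3,5]),
    ([9,0,0,9],53,[0,1,2,3],[0,1,2,3,5]),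
    ([9,0,1,0],53,[0,3,1,2],[0,2,4,3,5]),
    ([9,0,1,2],54,[1,0,2,3],[0,3,4,5]),
    ([9,0,1,3],51,[1,0,3,2],[2,0,5,3]),
    ([9,0,1,9],51,[0,2,3,1],[0,2,4,5]),
    ([9,0,3,0],53,[0,1,3,2],[0,2,1,3,5]),
    ([9,0,3,2],51,[1,0,2,3],[1,0,5,3]),
    ([9,0,3,3],51,[0,2,3,1],[0,1,2,5]),
    ([9,0,3,9],51,[0,2,3,1],[0,1,2,5]),
    ([9,0,9,0],53,[0,1,3,2],[0,2,1,3,5]),
    ([9,0,9,2],51,[0,2,3,1],[0,1,4,5]),
    ([9,0,9,3],51,[0,2,3,1],[0,1,2,5]),
    ([9,0,9,9],51,[0,2,3,1],[0,1,2,5]),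
    ([9,1,0,0],53,[0,3,2,1],[0,4,2,3,5]),
    ([9,1,0,2],51,[1,0,3,2],[0,3,4,5]),
    ([9,1,0,3],54,[2,0,1,3],[0,2,3,5]),
    ([9,1,0,9],51,[0,1,3,2],[0,2,4,5]),
    ([9,1,1,0],51,[0,1,2,3],[0,2,4,5]),
    ([9,1,3,0],51,[2,0,1,3],[0,2,3,5]),
    ([9,1,9,0],51,[0,1,2,3],[0,2,4,5]),
    ([9,2,0,0],53,[0,2,3,1],[0,4,1,3,5]),
    ([9,2,0,2],51,[0,1,3,2],[0,1,4,5]),
    ([9,2,0,3],51,[2,0,1,3],[1,0,5,3]),
    ([9,2,0,9],51,[0,1,3,2],[0,1,4,5]),
    ([9,2,1,0],51,[1,0,2,3],[0,3,4,5]),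
    ([9,2,3,0],54,[3,0,1,2],[0,1,3,5]),
    ([9,2,9,0],51,[0,1,2,3],[0,1,4,5]),
    ([9,9,0,0],53,[0,2,3,1],[0,4,1,3,5]),
    ([9,9,0,2],51,[0,1,3,2],[0,1,4,5]),
    ([9,9,0,3],51,[0,1,3,2],[0,1,2,5]),
    ([9,9,0,9],51,[0,1,3,2],[0,1,2,5]),
    ([9,9,1,0],51,[0,1,2,3],[0,2,4,5]),
    ([9,9,3,0],51,[0,1,2,3],[0,1,2,5]),
    ([9,9,9,0],51,[0,1,2,3],[0,1,2,5])]),
  ([[0,0,0,0],[1,1,1,1],[1,2,2,2],[2,3,2,1],[3,0,2,3]],
   [(0,0),(0,1),(1,0),(2,2),(2,0),(2,1)],
   [([2,1,9,0],55,[0,1,2,3],[0,1,2,4,5]),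
    ([2,1,9,2],54,[1,0,2,3],[0,1,5,4]),
    ([2,2,9,1],51,[1,0,2,3],[1,0,4,5]),
    ([3,1,9,0],51,[2,0,1,3],[0,2,3,5]),
    ([3,2,9,0],54,[3,0,1,2],[0,1,3,5]),
    ([3,2,9,1],56,[3,0,1,2],[0,3,5,2,1]),
    ([3,3,9,0],51,[0,1,2,3],[0,1,2,5]),
    ([3,9,9,0],51,[0,1,2,3],[0,1,2,5]),
    ([9,1,9,0],51,[2,0,1,3],[0,2,3,5]),
    ([9,2,9,1],51,[1,0,2,3],[1,0,4,5])]),
  ([[0,0,0,0],[1,1,1,1],[1,2,2,2],[2,3,2,1]],
   [(0,0),(0,1),(2,0),(2,2),(0,2),(2,1)],
   [([9,0,9,0],53,[0,1,3,2],[0,2,1,3,4]),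
    ([9,0,9,1],57,[0,1,3,2],[0,2,1,3,4]),
    ([9,0,9,2],51,[1,0,2,3],[1,0,4,3]),
    ([9,0,9,9],51,[0,2,3,1],[0,1,2,4]),
    ([9,1,9,0],51,[2,0,1,3],[0,2,3,4]),
    ([9,2,9,0],54,[3,0,1,2],[0,1,3,4]),
    ([9,2,9,1],56,[3,0,1,2],[0,3,4,2,1]),
    ([9,3,9,0],51,[0,1,2,3],[0,1,2,4]),
    ([9,9,9,0],51,[0,1,2,3],[0,1,2,4])]),
  ([[0,0,0,0],[1,1,1,1],[1,2,2,2],[2,3,2,0]],
   [(0,0),(0,1),(3,0),(0,2),(3,1),(3,2)],
   [([9,0,1,9],55,[1,2,3,0],[2,4,0,3,1]),
    ([9,0,2,9],58,[1,0,2,3],[1,0,4,3]),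
    ([9,1,0,9],55,[0,2,1,3],[0,2,1,4,3]),
    ([9,1,2,9],58,[0,3,1,2],[0,2,1,4]),
    ([9,2,1,9],51,[2,0,1,3],[0,1,4,3]),
    ([9,3,0,9],51,[0,1,3,2],[0,1,2,4])]),
  ([[0,0,0,0],[1,1,1,1],[1,2,2,2]],
   [(0,1),(0,0),(1,0),(2,0),(1,1),(1,2)],
   [([9,9,1,0],59,[0,1,2,3],[0,2,1,3]),
    ([9,9,1,2],58,[0,1,2,3],[0,2,1,3]),
    ([9,9,2,0],59,[0,1,2,3],[0,1,2,3]),
    ([9,9,2,1],58,[0,1,2,3],[0,1,2,3]),
    ([9,9,9,0],51,[0,1,2,3],[0,1,2,3])]),
  ([[0,0,0,0],[1,1,1,1]],
   [(0,0),(0,1),(1,0),(1,1),(2,0),(2,1)],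
   [([9,9,9,0],60,[3,0,1,2],[1,0,2]),
    ([9,9,9,1],60,[3,0,1,2],[0,1,2])])]"

text \<open>A finite computation, possible because all the tests are quantifications over explicit
  lists.\<close>

lemma valid_certificate: "valid_steps [] certificate"
  by code_simp

lemma certificate_two_disjoint: "list_ex (\<lambda>s. fst s = [[0,0,0,0],[1,1,1,1]]) certificate"
  by code_simp

text \<open>Two edges that do not cross realize the last configuration of the certificate, which is
  excluded.\<close>

lemma crossing_if_counterexample:
  assumes T: "counterexample T" and "e \<in> T" "f \<in> T"
  shows "crossing e f"
proof (rule ccontr)
  assume "\<not> crossing e f"
  then have "e p \<noteq> f p \<and> f p \<noteq> e p" if "p < 4" for p
    using that by (metis crossing_def)
  moreover have "[0,0,0,0::nat] ! p = 0 \<and> [1,1,1,1::nat] ! p = 1" if "p < 4" for p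
    using that by (auto simp: less_Suc_eq numeral_eq_Suc)
  \<comment> \<open>The parts stay in place, and the two label lists are sent to \<open>e\<close>
    and \<open>f\<close>.\<close>
  ultimately have "realizes T [[0,0,0,0],[1,1,1,1]] (\<lambda>x. if x = [0,0,0,0] then e else f) id"
    using assms(2,3) by (auto simp: realizes_def permutes_id)
  then have "occurs T [[0,0,0,0],[1,1,1,1]]"
    unfolding occurs_def by blast
  moreover obtain s where "s \<in> set certificate" "fst s = [[0,0,0,0],[1,1,1,1]]"
    using certificate_two_disjoint by (auto simp: list_ex_iff)
  ultimately show False
    using not_occurs_if_valid_steps[OF T _ valid_certificate, of s] by simp
qed

section \<open>Matching and covering numbers\<close>

lemma card_le_matching_number:
  assumes "matching E M" "finite M"
  shows "enat (card M) \<le> matching_number E"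
  unfolding matching_number_def using assms by (intro Sup_upper) blast

lemma matching_numberE:
  assumes "enat n < matching_number E"
  obtains M where "matching E M" "finite M" "n < card M"
  using assms unfolding matching_number_def less_Sup_iff by auto

lemma vertex_cover_number_le:
  assumes "vertex_cover V E C" "finite C" "card C \<le> n"
  shows "vertex_cover_number V E \<le> enat n"
proof -
  have "vertex_cover_number V E \<le> enat (card C)"
    unfolding vertex_cover_number_def using assms by (intro Inf_lower) blast
  also have "\<dots> \<le> enat n"
    using assms(3) by simp
  finally show ?thesis .
qed

theorem theorem1p1:
  fixes V :: "'a set" and P :: "nat \<Rightarrow> 'a set" and E :: "'a set set"
  assumes "uniform_hypergraph 4 V E"
    and "partite_hypergraph 4 P V E"
    and "matching_number E = 2"
  shows "vertex_cover_number V E \<le> 6"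
proof (rule ccontr)
  assume large: "\<not> vertex_cover_number V E \<le> 6"
  have V: "V = (\<Union>i\<in>{1..4}. P i)" and EV: "\<And>e. e \<in> E \<Longrightarrow> e \<subseteq> V"
    and ex1: "\<And>e i. e \<in> E \<Longrightarrow> i \<in> {1..4} \<Longrightarrow> \<exists>!v. v \<in> e \<inter> P i"
    using assms(1,2) by (auto simp: uniform_hypergraph_def partite_hypergraph_def)
  \<comment> \<open>Parts are numbered from 0 in configurations and from 1 in the hypergraph.\<close>
  define c where "c e p = (THE v. v \<in> e \<inter> P (Suc p))" for e p
  have cI: "c e p \<in> e \<inter> P (Suc p)" if "e \<in> E" "p < 4" for e p
    unfolding c_def using theI'[OF ex1[of e "Suc p"]] that by simp
  have c_eq: "c e p = v" if "e \<in> E" "p < 4" "v \<in> e" "v \<in> P (Suc p)" for e p v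
    using ex1[of e "Suc p"] cI[of e p] that by auto
  have crossing_iff: "crossing (c e) (c f) \<longleftrightarrow> e \<inter> f \<noteq> {}" if ef: "e \<in> E" "f \<in> E" for e f
  proof
    assume "crossing (c e) (c f)"
    then show "e \<inter> f \<noteq> {}"
      using cI ef by (auto simp: crossing_def) (metis disjoint_iff)
  next
    assume "e \<inter> f \<noteq> {}"
    then obtain v where v: "v \<in> e" "v \<in> f"
      by blast
    then obtain i where i: "i \<in> {1..4}" "v \<in> P i"
      using EV[OF ef(1)] V by auto
    \<comment> \<open>Each edge has only one vertex in \<open>P i\<close>, so both must select the
      common vertex \<open>v\<close> there.\<close>
    then have "c e (i - 1) = v" "c f (i - 1) = v"
      using ef v by (auto intro!: c_eq)
    then show "crossing (c e) (c f)"
      using i(1) unfolding crossing_def by (intro exI[of _ "i - 1"]) auto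
  qed
  \<comment> \<open>Disjoint edges are distinct only if they are not both empty; this gives the
    matching \<open>{d, e, f}\<close> its three elements.\<close>
  have nonempty: "e \<noteq> {}" if "e \<in> E" for e
    using cI[OF that, of 0] by auto
  have "counterexample (c ` E)"
    unfolding counterexample_def
  proof (intro conjI ballI allI impI)
    fix d' e' f'
    assume "d' \<in> c ` E" "e' \<in> c ` E" "f' \<in> c ` E"
    then obtain d e f where def: "d \<in> E" "e \<in> E" "f \<in> E" "d' = c d" "e' = c e" "f' = c f"
      by auto
    show "crossing d' e' \<or> crossing d' f' \<or> crossing e' f'"
    proof (rule ccontr)
      assume "\<not> ?thesis"
      then have dis: "d \<inter> e = {}" "d \<inter> f = {}" "e \<inter> f = {}"
        using def crossing_iff by auto
      then have "matching E {d, e, f}"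
        using def by (auto simp: matching_def disjoint_def)
      moreover have "card {d, e, f} = 3"
        using dis nonempty def by (auto simp: card_insert_if)
      ultimately have "enat 3 \<le> matching_number E"
        using card_le_matching_number[of E "{d, e, f}"] by simp
      then show False
        using assms(3) by (simp add: numeral_eq_enat)
    qed
  next
    fix A :: "(nat \<times> 'a) set"
    assume A: "finite A \<and> card A \<le> 6"
    show "\<exists>e'\<in>c ` E. \<forall>(p, v)\<in>A. p < 4 \<longrightarrow> e' p \<noteq> v"
    proof (rule ccontr)
      assume no: "\<not> ?thesis"
      \<comment> \<open>The tags are dropped, which cannot increase the size. Intersecting with
        \<open>V\<close> is needed because \<open>A\<close> is arbitrary while a cover must lie in
        \<open>V\<close>.\<close>
      define C where "C = snd ` A \<inter> V"
      have "e \<inter> C \<noteq> {}" if e: "e \<in> E" for e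
      proof -
        obtain p where p: "(p, c e p) \<in> A" "p < 4"
          using no e by fastforce
        then have "c e p \<in> e"
          using cI[OF e] by auto
        moreover from this have "c e p \<in> V"
          using EV[OF e] by auto
        ultimately show ?thesis
          using p(1) unfolding C_def by force
      qed
      then have "vertex_cover V E C"
        by (auto simp: vertex_cover_def C_def)
      moreover have "finite C" "card C \<le> 6"
        using A card_image_le[of A snd] card_mono[of "snd ` A" C]
        unfolding C_def by (auto intro: order_trans)
      ultimately show False
        using vertex_cover_number_le[of V E C 6] large by (simp add: numeral_eq_enat)
    qed
  qed
  then have intersecting: "e \<inter> f \<noteq> {}" if "e \<in> E" "f \<in> E" for e f
    using crossing_if_counterexample[of "c ` E" "c e" "c f"] crossing_iff that by simp
  \<comment> \<open>Since \<open>1 < 2\<close>, some finite matching has at least two edges, and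
    these contradict \<open>intersecting\<close>.\<close>
  obtain M where M: "matching E M" "finite M" "1 < card M"
    using matching_numberE[of 1 E] assms(3) by (auto simp: numeral_eq_enat)
  then obtain e f where "e \<in> M" "f \<in> M" "e \<noteq> f"
    by (metis One_nat_def card_le_Suc0_iff_eq not_less)
  then show False
    using M(1) intersecting[of e f] by (auto simp: matching_def disjoint_def)
qed

end
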